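(* Let $F$ be a field, let $l,d\in\mathbb{N}$ and $\kappa=(k_1,\ldots,k_l)\in(\mathbb{Z}/2\mathbb{Z})^l$, and set $\Lambda=\Lambda_{k_1}+\cdots+\Lambda_{k_l}$. For every $l$-multipartition $\lambda\in\mathscr{P}^{\kappa}_d$, the graded dimension of the graded Specht module $S(\lambda)$ of the cyclotomic KLR algebra $H^{\Lambda}_d$ over $F$ satisfies $$(\operatorname{qdim}S(\lambda))(u)\in\mathbb{N}\,u^{\epsilon(\lambda)}.$$
   Context: $\mathbb{N}$ is the set of nonnegative integers and $I=\mathbb{Z}/2\mathbb{Z}=\{0,1\}$. $\mathscr{P}^{\kappa}_d$ is the set of $l$-multipartitions of $d$, i.e. $l$-tuples $\lambda=(\lambda^{(1)},\ldots,\lambda^{(l)})$ of partitions with $\sum_m|\lambda^{(m)}|=d$. Nodes and residues. A node is an element of $\mathbb{Z}_{>0}\times\mathbb{Z}_{>0}\times\{1,\ldots,l\}$. The Young diagram of $\lambda$ is $Y(\lambda)=\{(a,b,m): 1\le b\le\lambda^{(m)}_a\}$. The residue of $(a,b,m)$ is $k_m+(b-a)+2\mathbb{Z}\in I$; a node of residue $i$ is an $i$-node. A node $N\in Y(\lambda)$ is removable if $Y(\lambda)\setminus\{N\}$ is the Young diagram of a multipartition; $N'\notin Y(\lambda)$ is addable for $\lambda$ if $Y(\lambda)\cup\{N'\}$ is the Young diagram of a multipartition. $(a',b',m')$ is below $(a,b,m)$ if $m'>m$, or $m'=m$ and $a'>a$. Tableaux and degrees. A $\lambda$-tableau is a bijective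 assignment of $1,\ldots,d$ to the nodes of $\lambda$; it is standard if, within each component, entries increase along rows and down columns. $\mathscr{T}(\lambda)$ is the set of standard $\lambda$-tableaux. The residue sequence of $\mathtt{t}$ is $(i_1,\ldots,i_d)\in I^d$, with $i_r$ the residue of the node occupied by $r$. For standard $\mathtt{t}$ with $d\ge 1$, let $N$ be the node occupied by $d$, $i$ its residue, and $d_N(\lambda)=\#\{\text{addable }i\text{-nodes for }\lambda\text{ below }N\}-\#\{\text{removable }i\text{-nodes of }\lambda\text{ below }N\}$. Define $\deg(\mathtt{t})=d_N(\lambda)+\deg(\mathtt{t}_{\le(d-1)})$ recursively, where $\mathtt{t}_{\le r}$ consists of the boxes occupied by $1,\ldots,r$, and the empty tableau has degree $0$. $\mathtt{t}^{\lambda}$ is the standard $\lambda$-tableau filled with $1,\ldots,d$ along successive rows from top to bottom (component $1$ first, then component $2$, etc.); $\mathbf{i}^\lambda$ is its residue sequence. Parity. For a partition $\nu=(\nu_1,\ldots,\nu_n)$, $\epsilon(\nu)=\sum_i\lfloor\nu_i/2\rfloor+2\mathbb{Z}\in\mathbb{Z}/2\mathbb{Z}$. For $\lambda\in\mathscr{P}^\kappa_d$, $\epsilon(\lambda)=\epsilon(\lambda^{(1)})+\cdots+\epsilon(\lambda^{(l)})+\sum_{j=1}^{l-1}\sum_{m=j+1}^{l}n_{k_m}(\lambda^{(j)})+2\mathbb{Z}$, where $n_i(\lambda^{(j)})$ is the number of $i$-nodes $(a,b,j)\in Y(\lambda)$ in component $j$. The algebra. $\Lambda_0,\Lambda_1$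 are the fundamental weights and $\alpha_0^\vee,\alpha_1^\vee$ the simple coroots for the Cartan matrix $(a_{ij})_{i,j\in I}=\begin{pmatrix}2&-2\\-2&2\end{pmatrix}$, with $(\alpha_i^\vee,\Lambda_j)=\delta_{ij}$; so $(\alpha_i^\vee,\Lambda)=\#\{m: k_m=i\}$. $H^\Lambda_d$ is the unital $F$-algebra with generators $e(\mathbf{i})$ ($\mathbf{i}\in I^d$), $y_1,\ldots,y_d$, $\psi_1,\ldots,\psi_{d-1}$ and relations: $e(\mathbf{i})e(\mathbf{j})=\delta_{\mathbf{i}\mathbf{j}}e(\mathbf{i})$; $\sum_{\mathbf i}e(\mathbf{i})=1$; $y_re(\mathbf{i})=e(\mathbf{i})y_r$; $\psi_re(\mathbf{i})=e(s_r\mathbf{i})\psi_r$; $y_ry_s=y_sy_r$; $\psi_ry_s=y_s\psi_r$ if $s\ne r,r+1$; $\psi_r\psi_s=\psi_s\psi_r$ if $|r-s|>1$; $\psi_ry_{r+1}e(\mathbf{i})=(y_r\psi_r+\delta_{i_r,i_{r+1}})e(\mathbf{i})$; $y_{r+1}\psi_re(\mathbf{i})=(\psi_ry_r+\delta_{i_r,i_{r+1}})e(\mathbf{i})$; $\psi_r^2e(\mathbf{i})=0$ if $i_r=i_{r+1}$ and $\psi_r^2e(\mathbf{i})=(y_{r+1}-y_r)(y_r-y_{r+1})e(\mathbf{i})$ if $i_r\ne i_{r+1}$; $\psi_r\psi_{r+1}\psi_re(\mathbf{i})=(\psi_{r+1}\psi_r\psi_{r+1}-2y_{r+1}+y_r+y_{r+2})e(\mathbf{i})$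 if $i_r=i_{r+2}\ne i_{r+1}$, and $\psi_r\psi_{r+1}\psi_re(\mathbf{i})=\psi_{r+1}\psi_r\psi_{r+1}e(\mathbf{i})$ otherwise; and the cyclotomic relation $y_1^{(\alpha_{i_1}^\vee,\Lambda)}e(\mathbf{i})=0$. It is $\mathbb{Z}$-graded by $\deg e(\mathbf{i})=0$, $\deg y_r=2$, $\deg(\psi_re(\mathbf{i}))=-a_{i_r,i_{r+1}}$, i.e. $-2$ if $i_r=i_{r+1}$ and $2$ if $i_r\neq i_{r+1}$. Let $*$ be the anti-automorphism of $H^\Lambda_d$ fixing all the generators. Graded Specht modules. These are the cell modules of the graded cellular structure of Hu and Mathas. For $\mathtt{t}\in\mathscr{T}(\lambda)$ let $w_{\mathtt{t}}\in\mathfrak{S}_d$ satisfy $w_{\mathtt{t}}\mathtt{t}^\lambda=\mathtt{t}$ (action on entries), fix a reduced expression $w_{\mathtt{t}}=s_{r_1}\cdots s_{r_m}$ in $s_r=(r,r+1)$, and set $\psi_{w_{\mathtt{t}}}=\psi_{r_1}\cdots\psi_{r_m}$. Let $y^\lambda=\prod_{r=1}^dy_r^{c_r}$ with $c_r$ the number of addable nodes for the shape of $\mathtt{t}^\lambda_{\le r}$ that lie below the node occupied by $r$ in $\mathtt{t}^\lambda$ and have the same residue as that node. The elements $\psi_{\mathtt{s}\mathtt{t}}=\psi_{w_{\mathtt{s}}}e(\mathbf{i}^\lambda)y^\lambda\psi_{w_{\mathtt{t}}}^*$ ($\mathtt{s},\mathtt{t}\in\mathscr{T}(\lambda)$, $\lambda\in\mathscr{P}^\kappa_d$)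 form a graded cellular basis of $H^\Lambda_d$ with $\deg\psi_{\mathtt{s}\mathtt{t}}=\deg\mathtt{s}+\deg\mathtt{t}$, with respect to the dominance order ($\mu\trianglerighteq\lambda$ iff $\sum_{k<m}|\mu^{(k)}|+\sum_{a\le c}\mu^{(m)}_a\ge\sum_{k<m}|\lambda^{(k)}|+\sum_{a\le c}\lambda^{(m)}_a$ for all $m,c$). Let $H^{\rhd\lambda}$ be the two-sided ideal spanned by the $\psi_{\mathtt{s}\mathtt{t}}$ with $\mathtt{s},\mathtt{t}$ of shape $\mu\rhd\lambda$. $S(\lambda)$ is the graded left $H^\Lambda_d$-module with homogeneous basis $\{z_{\mathtt{t}}:\mathtt{t}\in\mathscr{T}(\lambda)\}$, $\deg z_{\mathtt{t}}=\deg(\mathtt{t})$, and action $hz_{\mathtt{s}}=\sum_{\mathtt{v}}r_{\mathtt{v}}z_{\mathtt{v}}$ where $h\psi_{\mathtt{s}\mathtt{t}}\equiv\sum_{\mathtt{v}}r_{\mathtt{v}}\psi_{\mathtt{v}\mathtt{t}}$ mod $H^{\rhd\lambda}$ (independent of $\mathtt{t}$). Graded dimension and $u$. For a finite-dimensional graded space $M=\bigoplus_nM_n$, $\operatorname{qdim}M=\sum_n(\dim M_n)q^n\in\mathbb{Z}[q,q^{-1}]$. Let $S=\mathbb{Z}[q,q^{-1}]/(q^2-1)\mathbb{Z}[q,q^{-1}]$ and let $u$ be the image of $q$ in $S$, so $S=\mathbb{Z}1\oplus\mathbb{Z}u$ and $u^2=1$; $f(u)$ denotes the image in $S$ of $f\in\mathbb{Z}[q,q^{-1}]$,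 and $u^m$ is well-defined for $m\in\mathbb{Z}/2\mathbb{Z}$. *)

theory Defs
  imports
    Complex_Main
    "HOL-Combinatorics.Permutations"
    "HOL-Library.Poly_Mapping"
    "HOL-Library.FuncSet"
    "HOL-Library.Z2"
    "HOL-Algebra.QuotRing"
    "HOL-Algebra.Module"
begin

text \<open>
  Residues live in \<^typ>\<open>bit\<close>, the field of integers mod 2. The multicharge is a list
  \<open>kap\<close> of residues. Components, rows, columns and tableau entries are numbered from 1,
  whereas Isabelle lists are indexed from 0; hence the shifts below.
\<close>

definition is_partition :: "nat list \<Rightarrow> bool" where
  "is_partition nu \<longleftrightarrow> sorted_wrt (\<ge>) nu \<and> 0 \<notin> set nu"

definition part :: "nat list \<Rightarrow> nat \<Rightarrow> nat" where
  "part nu a = (if 1 \<le> a \<and> a \<le> length nu then nu ! (a - 1) else 0)"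

type_synonym multipartition = "nat list list"

definition mp_size :: "multipartition \<Rightarrow> nat" where
  "mp_size lam = (\<Sum>nu\<leftarrow>lam. sum_list nu)"

definition multipartitions :: "nat \<Rightarrow> nat \<Rightarrow> multipartition set" where
  "multipartitions l d =
    {lam. length lam = l \<and> (\<forall>nu\<in>set lam. is_partition nu) \<and> mp_size lam = d}"

text \<open>A node \<open>(a, b, m)\<close> is row \<open>a\<close>, column \<open>b\<close>, component \<open>m\<close>.\<close>

type_synonym node = "nat \<times> nat \<times> nat"

definition diagram :: "multipartition \<Rightarrow> node set" where
  "diagram lam = {(a, b, m). 1 \<le> m \<and> m \<le> length lam \<and> 1 \<le> a \<and>
                             1 \<le> b \<and> b \<le> part (lam ! (m - 1)) a}"

definition is_diagram :: "nat \<Rightarrow> node set \<Rightarrow> bool" where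
  "is_diagram l X \<longleftrightarrow> (\<exists>d. X \<in> diagram ` multipartitions l d)"

definition addable :: "nat \<Rightarrow> node set \<Rightarrow> node \<Rightarrow> bool" where
  "addable l X N \<longleftrightarrow> N \<notin> X \<and> is_diagram l (insert N X)"

definition removable :: "nat \<Rightarrow> node set \<Rightarrow> node \<Rightarrow> bool" where
  "removable l X N \<longleftrightarrow> N \<in> X \<and> is_diagram l (X - {N})"

definition node_res :: "bit list \<Rightarrow> node \<Rightarrow> bit" where
  "node_res kap N = (case N of (a, b, m) \<Rightarrow> kap ! (m - 1) + of_int (int b - int a))"

text \<open>\<open>below N' N\<close> means that \<open>N'\<close> is below \<open>N\<close>.\<close>

definition below :: "node \<Rightarrow> node \<Rightarrow> bool" where
  "below N' N = (case (N', N) of ((a', b', m'), (a, b, m)) \<Rightarrow> m < m' \<or> (m' = m \<and> a < a'))"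

definition addable_below :: "bit list \<Rightarrow> node set \<Rightarrow> node \<Rightarrow> node set" where
  "addable_below kap X N =
    {A. addable (length kap) X A \<and> node_res kap A = node_res kap N \<and> below A N}"

definition removable_below :: "bit list \<Rightarrow> node set \<Rightarrow> node \<Rightarrow> node set" where
  "removable_below kap X N =
    {A. removable (length kap) X A \<and> node_res kap A = node_res kap N \<and> below A N}"

definition node_deg :: "bit list \<Rightarrow> node set \<Rightarrow> node \<Rightarrow> int" where
  "node_deg kap X N = int (card (addable_below kap X N)) - int (card (removable_below kap X N))"

text \<open>Tableaux are normalised to be \<^const>\<open>undefined\<close> off the diagram, so that distinct
  functions are distinct tableaux.\<close>

type_synonym tableau = "node \<Rightarrow> nat"

definition tableaux :: "multipartition \<Rightarrow> tableau set" where
  "tableaux lam =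
    {t \<in> extensional (diagram lam). bij_betw t (diagram lam) {1..mp_size lam}}"

definition std_tableaux :: "multipartition \<Rightarrow> tableau set" where
  "std_tableaux lam = {t \<in> tableaux lam.
     (\<forall>a b m. (a, b, m) \<in> diagram lam \<and> (a, Suc b, m) \<in> diagram lam \<longrightarrow> t (a, b, m) < t (a, Suc b, m)) \<and>
     (\<forall>a b m. (a, b, m) \<in> diagram lam \<and> (Suc a, b, m) \<in> diagram lam \<longrightarrow> t (a, b, m) < t (Suc a, b, m))}"

definition node_at :: "multipartition \<Rightarrow> tableau \<Rightarrow> nat \<Rightarrow> node" where
  "node_at lam t r = inv_into (diagram lam) t r"

definition shape_upto :: "multipartition \<Rightarrow> tableau \<Rightarrow> nat \<Rightarrow> node set" where
  "shape_upto lam t r = {N \<in> diagram lam. t N \<le> r}"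

definition res_seq :: "bit list \<Rightarrow> multipartition \<Rightarrow> tableau \<Rightarrow> bit list" where
  "res_seq kap lam t = map (\<lambda>r. node_res kap (node_at lam t r)) [1..<Suc (mp_size lam)]"

text \<open>\<open>deg_upto kap lam t r\<close> is the degree of the restriction of \<open>t\<close> to its entries \<open>1, \<dots>, r\<close>.\<close>

primrec deg_upto :: "bit list \<Rightarrow> multipartition \<Rightarrow> tableau \<Rightarrow> nat \<Rightarrow> int" where
  "deg_upto kap lam t 0 = 0"
| "deg_upto kap lam t (Suc r) =
    node_deg kap (shape_upto lam t (Suc r)) (node_at lam t (Suc r)) + deg_upto kap lam t r"

definition tab_deg :: "bit list \<Rightarrow> multipartition \<Rightarrow> tableau \<Rightarrow> int" where
  "tab_deg kap lam t = deg_upto kap lam t (mp_size lam)"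

definition init_tab :: "multipartition \<Rightarrow> tableau" where
  "init_tab lam = restrict (\<lambda>(a, b, m).
      (\<Sum>k = 1..<m. sum_list (lam ! (k - 1))) + (\<Sum>c = 1..<a. part (lam ! (m - 1)) c) + b)
    (diagram lam)"

definition dominates :: "multipartition \<Rightarrow> multipartition \<Rightarrow> bool" where
  "dominates mu lam \<longleftrightarrow> (\<forall>m\<in>{1..length lam}. \<forall>c.
      (\<Sum>k = 1..<m. sum_list (lam ! (k - 1))) + (\<Sum>a = 1..c. part (lam ! (m - 1)) a)
    \<le> (\<Sum>k = 1..<m. sum_list (mu ! (k - 1))) + (\<Sum>a = 1..c. part (mu ! (m - 1)) a))"

definition part_parity :: "nat list \<Rightarrow> bit" where
  "part_parity nu = of_nat (\<Sum>x\<leftarrow>nu. x div 2)"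

definition res_count :: "bit list \<Rightarrow> multipartition \<Rightarrow> bit \<Rightarrow> nat \<Rightarrow> nat" where
  "res_count kap lam i j =
    card {(a, b, m). (a, b, m) \<in> diagram lam \<and> m = j \<and> node_res kap (a, b, m) = i}"

definition mp_parity :: "bit list \<Rightarrow> multipartition \<Rightarrow> bit" where
  "mp_parity kap lam =
    (\<Sum>m = 1..length kap. part_parity (lam ! (m - 1))) +
    (\<Sum>j = 1..length kap - 1. \<Sum>m = j + 1..length kap.
        of_nat (res_count kap lam (kap ! (m - 1)) j))"

datatype klr_gen = GenE "bit list" | GenY nat | GenPsi nat

datatype klr_word = Word (letters: "klr_gen list")

instantiation klr_word :: monoid_add
begin

definition zero_klr_word :: klr_word where "0 = Word []"

definition plus_klr_word :: "klr_word \<Rightarrow> klr_word \<Rightarrow> klr_word" where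
  "v + w = Word (letters v @ letters w)"

instance
  by standard (simp_all add: zero_klr_word_def plus_klr_word_def)

end

text \<open>The product of \<^typ>\<open>klr_word \<Rightarrow>\<^sub>0 'f\<close> is convolution over concatenation of words, so this type
  is the free algebra on all symbols of \<^typ>\<open>klr_gen\<close>; \<open>klr_free d\<close> is the subalgebra on the
  generators that occur for the given \<open>d\<close>.\<close>

type_synonym 'f klr_poly = "klr_word \<Rightarrow>\<^sub>0 'f"

definition residue_seqs :: "nat \<Rightarrow> bit list set" where
  "residue_seqs d = {i. length i = d}"

definition klr_gens :: "nat \<Rightarrow> klr_gen set" where
  "klr_gens d = GenE ` residue_seqs d \<union> GenY ` {1..d} \<union> GenPsi ` {1..<d}"

definition klr_free :: "nat \<Rightarrow> ('f::field) klr_poly ring" where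
  "klr_free d = \<lparr>carrier = {p. \<forall>w\<in>Poly_Mapping.keys p. set (letters w) \<subseteq> klr_gens d},
     monoid.mult = (*), one = 1, zero = 0, add = (+)\<rparr>"

definition gE :: "bit list \<Rightarrow> ('f::field) klr_poly" where
  "gE i = Poly_Mapping.single (Word [GenE i]) 1"

definition gY :: "nat \<Rightarrow> ('f::field) klr_poly" where
  "gY r = Poly_Mapping.single (Word [GenY r]) 1"

definition gPsi :: "nat \<Rightarrow> ('f::field) klr_poly" where
  "gPsi r = Poly_Mapping.single (Word [GenPsi r]) 1"

definition ent :: "bit list \<Rightarrow> nat \<Rightarrow> bit" where
  "ent i r = i ! (r - 1)"

definition swap_seq :: "nat \<Rightarrow> bit list \<Rightarrow> bit list" where
  "swap_seq r i = i[r - 1 := ent i (Suc r), r := ent i r]"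

text \<open>\<open>coroot_pairing kap i\<close> is the pairing of the coroot indexed by \<open>i\<close> with \<open>\<Lambda>\<close>, the sum over
  \<open>m\<close> of the fundamental weights indexed by the entries \<open>k\<^sub>m\<close> of \<open>kap\<close>.\<close>

definition coroot_pairing :: "bit list \<Rightarrow> bit \<Rightarrow> nat" where
  "coroot_pairing kap i = card {m \<in> {1..length kap}. kap ! (m - 1) = i}"

text \<open>\<open>klr_rel kap d p q\<close>: the relation \<open>p = q\<close> is one of the defining relations.\<close>

inductive klr_rel :: "bit list \<Rightarrow> nat \<Rightarrow> ('f::field) klr_poly \<Rightarrow> 'f klr_poly \<Rightarrow> bool"
  for kap :: "bit list" and d :: nat where
  idem: "i \<in> residue_seqs d \<Longrightarrow> j \<in> residue_seqs d \<Longrightarrow>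
    klr_rel kap d (gE i * gE j) (if i = j then gE i else 0)"
| unit: "klr_rel kap d (\<Sum>i\<in>residue_seqs d. gE i) 1"
| y_e: "i \<in> residue_seqs d \<Longrightarrow> r \<in> {1..d} \<Longrightarrow> klr_rel kap d (gY r * gE i) (gE i * gY r)"
| psi_e: "i \<in> residue_seqs d \<Longrightarrow> r \<in> {1..<d} \<Longrightarrow>
    klr_rel kap d (gPsi r * gE i) (gE (swap_seq r i) * gPsi r)"
| y_y: "r \<in> {1..d} \<Longrightarrow> s \<in> {1..d} \<Longrightarrow> klr_rel kap d (gY r * gY s) (gY s * gY r)"
| psi_y: "r \<in> {1..<d} \<Longrightarrow> s \<in> {1..d} \<Longrightarrow> s \<noteq> r \<Longrightarrow> s \<noteq> Suc r \<Longrightarrow>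
    klr_rel kap d (gPsi r * gY s) (gY s * gPsi r)"
| psi_psi: "r \<in> {1..<d} \<Longrightarrow> s \<in> {1..<d} \<Longrightarrow> 1 < \<bar>int r - int s\<bar> \<Longrightarrow>
    klr_rel kap d (gPsi r * gPsi s) (gPsi s * gPsi r)"
| psi_y_Suc: "i \<in> residue_seqs d \<Longrightarrow> r \<in> {1..<d} \<Longrightarrow>
    klr_rel kap d (gPsi r * gY (Suc r) * gE i)
      ((gY r * gPsi r + (if ent i r = ent i (Suc r) then 1 else 0)) * gE i)"
| y_Suc_psi: "i \<in> residue_seqs d \<Longrightarrow> r \<in> {1..<d} \<Longrightarrow>
    klr_rel kap d (gY (Suc r) * gPsi r * gE i)
      ((gPsi r * gY r + (if ent i r = ent i (Suc r) then 1 else 0)) * gE i)"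
| quadratic_eq: "i \<in> residue_seqs d \<Longrightarrow> r \<in> {1..<d} \<Longrightarrow> ent i r = ent i (Suc r) \<Longrightarrow>
    klr_rel kap d (gPsi r ^ 2 * gE i) 0"
| quadratic_neq: "i \<in> residue_seqs d \<Longrightarrow> r \<in> {1..<d} \<Longrightarrow> ent i r \<noteq> ent i (Suc r) \<Longrightarrow>
    klr_rel kap d (gPsi r ^ 2 * gE i) ((gY (Suc r) - gY r) * (gY r - gY (Suc r)) * gE i)"
| braid_special: "i \<in> residue_seqs d \<Longrightarrow> r \<in> {1..<d} \<Longrightarrow> Suc r \<in> {1..<d} \<Longrightarrow>
    ent i r = ent i (r + 2) \<Longrightarrow> ent i r \<noteq> ent i (Suc r) \<Longrightarrow>
    klr_rel kap d (gPsi r * gPsi (Suc r) * gPsi r * gE i)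
      ((gPsi (Suc r) * gPsi r * gPsi (Suc r) - 2 * gY (Suc r) + gY r + gY (r + 2)) * gE i)"
| braid_other: "i \<in> residue_seqs d \<Longrightarrow> r \<in> {1..<d} \<Longrightarrow> Suc r \<in> {1..<d} \<Longrightarrow>
    \<not> (ent i r = ent i (r + 2) \<and> ent i r \<noteq> ent i (Suc r)) \<Longrightarrow>
    klr_rel kap d (gPsi r * gPsi (Suc r) * gPsi r * gE i)
      (gPsi (Suc r) * gPsi r * gPsi (Suc r) * gE i)"
| cyclotomic: "1 \<le> d \<Longrightarrow> i \<in> residue_seqs d \<Longrightarrow>
    klr_rel kap d (gY 1 ^ coroot_pairing kap (ent i 1) * gE i) 0"

definition klr_ideal :: "bit list \<Rightarrow> nat \<Rightarrow> ('f::field) klr_poly set" where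
  "klr_ideal kap d = genideal (klr_free d) {p - q | p q. klr_rel kap d p q}"

definition klr_class :: "bit list \<Rightarrow> nat \<Rightarrow> ('f::field) klr_poly \<Rightarrow> 'f klr_poly set" where
  "klr_class kap d p = klr_ideal kap d +>\<^bsub>klr_free d\<^esub> p"

definition klr_ring :: "bit list \<Rightarrow> nat \<Rightarrow> ('f::field) klr_poly set ring" where
  "klr_ring kap d = klr_free d Quot klr_ideal kap d"

definition klr_alg :: "bit list \<Rightarrow> nat \<Rightarrow> ('f::field, 'f klr_poly set) module" where
  "klr_alg kap d = ring.extend (klr_ring kap d) (module.fields
     (\<lambda>c X. klr_class kap d (Poly_Mapping.single 0 c) \<otimes>\<^bsub>klr_ring kap d\<^esub> X))"

definition lin_span :: "('f, 'a, 'm) module_scheme \<Rightarrow> 'a set \<Rightarrow> 'a set" where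
  "lin_span A B = {\<Oplus>\<^bsub>A\<^esub>b\<in>X. c b \<odot>\<^bsub>A\<^esub> b | X c. finite X \<and> X \<subseteq> B}"

text \<open>The grading of the algebra: \<open>klr_monomial d n p\<close> says that \<open>p\<close> is a product of the homogeneous
  elements \<open>e(i)\<close>, \<open>y\<^sub>r\<close>, \<open>\<psi>\<^sub>r e(i)\<close> whose degrees add up to \<open>n\<close>.\<close>

inductive klr_monomial :: "nat \<Rightarrow> int \<Rightarrow> ('f::field) klr_poly \<Rightarrow> bool" for d :: nat where
  "klr_monomial d 0 1"
| "klr_monomial d n p \<Longrightarrow> i \<in> residue_seqs d \<Longrightarrow> klr_monomial d n (gE i * p)"
| "klr_monomial d n p \<Longrightarrow> r \<in> {1..d} \<Longrightarrow> klr_monomial d (n + 2) (gY r * p)"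
| "klr_monomial d n p \<Longrightarrow> i \<in> residue_seqs d \<Longrightarrow> r \<in> {1..<d} \<Longrightarrow>
    klr_monomial d (n + (if ent i r = ent i (Suc r) then - 2 else 2)) (gPsi r * gE i * p)"

definition klr_component :: "bit list \<Rightarrow> nat \<Rightarrow> int \<Rightarrow> ('f::field) klr_poly set set" where
  "klr_component kap d n = lin_span (klr_alg kap d) {klr_class kap d p | p. klr_monomial d n p}"

text \<open>The anti-automorphism fixing the generators reverses words. It preserves the defining ideal,
  so on cosets it is the image.\<close>

definition free_star :: "('f::field) klr_poly \<Rightarrow> 'f klr_poly" where
  "free_star p =
    (\<Sum>w\<in>Poly_Mapping.keys p. Poly_Mapping.single (Word (rev (letters w))) (Poly_Mapping.lookup p w))"

definition klr_star :: "('f::field) klr_poly set \<Rightarrow> 'f klr_poly set" where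
  "klr_star X = free_star ` X"

lemma klr_free_carrier_mult:
  assumes "p \<in> carrier (klr_free d)" "q \<in> carrier (klr_free d)"
  shows "p * q \<in> carrier (klr_free d)"
proof -
  have "set (letters w) \<subseteq> klr_gens d" if w: "w \<in> Poly_Mapping.keys (p * q)" for w
  proof -
    obtain u v where "u \<in> Poly_Mapping.keys p" "v \<in> Poly_Mapping.keys q" "w = u + v"
      using w keys_mult[of p q] by blast
    then show ?thesis
      using assms by (auto simp: klr_free_def plus_klr_word_def)
  qed
  then show ?thesis by (simp add: klr_free_def)
qed

lemma klr_free_carrier_add:
  assumes "p \<in> carrier (klr_free d)" "q \<in> carrier (klr_free d)"
  shows "p + q \<in> carrier (klr_free d)"
  using assms keys_add[of p q] by (fastforce simp: klr_free_def)

lemma klr_free_carrier_uminus: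
  "p \<in> carrier (klr_free d) \<Longrightarrow> - p \<in> carrier (klr_free d)"
  by (simp add: klr_free_def)

lemma klr_free_carrier_one: "1 \<in> carrier (klr_free d)"
  by (simp add: klr_free_def zero_klr_word_def)

lemma klr_free_carrier_zero: "0 \<in> carrier (klr_free d)"
  by (simp add: klr_free_def)

lemma klr_free_ring: "ring (klr_free d :: ('f::field) klr_poly ring)"
proof (rule ringI)
  show "abelian_group (klr_free d :: 'f klr_poly ring)"
  proof (rule abelian_groupI)
    fix x :: "'f klr_poly" assume "x \<in> carrier (klr_free d)"
    then show "\<exists>y\<in>carrier (klr_free d). y \<oplus>\<^bsub>klr_free d\<^esub> x = \<zero>\<^bsub>klr_free d\<^esub>"
      by (intro bexI[of _ "- x"] klr_free_carrier_uminus) (simp_all add: klr_free_def)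
  next
    fix x y :: "'f klr_poly" assume "x \<in> carrier (klr_free d)" "y \<in> carrier (klr_free d)"
    then show "x \<oplus>\<^bsub>klr_free d\<^esub> y \<in> carrier (klr_free d)"
      using klr_free_carrier_add[of x d y] by (simp add: klr_free_def)
  qed (auto simp: klr_free_def algebra_simps)
  show "Group.monoid (klr_free d :: 'f klr_poly ring)"
  proof (rule Group.monoidI)
    fix x y :: "'f klr_poly" assume "x \<in> carrier (klr_free d)" "y \<in> carrier (klr_free d)"
    then show "x \<otimes>\<^bsub>klr_free d\<^esub> y \<in> carrier (klr_free d)"
      using klr_free_carrier_mult[of x d y] by (simp add: klr_free_def)
  qed (use klr_free_carrier_one in \<open>auto simp: klr_free_def algebra_simps\<close>)
qed (auto simp: klr_free_def algebra_simps)

lemma gE_carrier: "i \<in> residue_seqs d \<Longrightarrow> gE i \<in> carrier (klr_free d)"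
  by (simp add: klr_free_def gE_def klr_gens_def)

lemma gY_carrier: "r \<in> {1..d} \<Longrightarrow> gY r \<in> carrier (klr_free d)"
  by (simp add: klr_free_def gY_def klr_gens_def)

lemma gPsi_carrier: "r \<in> {1..<d} \<Longrightarrow> gPsi r \<in> carrier (klr_free d)"
  by (simp add: klr_free_def gPsi_def klr_gens_def)

lemma klr_free_carrier_diff:
  "p \<in> carrier (klr_free d) \<Longrightarrow> q \<in> carrier (klr_free d) \<Longrightarrow> p - q \<in> carrier (klr_free d)"
  using klr_free_carrier_add[of p d "- q"] klr_free_carrier_uminus[of q d] by simp

lemma klr_free_carrier_power:
  "p \<in> carrier (klr_free d) \<Longrightarrow> p ^ n \<in> carrier (klr_free d)"
  by (induction n) (auto intro: klr_free_carrier_mult klr_free_carrier_one)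

lemma klr_free_carrier_sum:
  "(\<And>x. x \<in> A \<Longrightarrow> f x \<in> carrier (klr_free d)) \<Longrightarrow> sum f A \<in> carrier (klr_free d)"
  by (induction A rule: infinite_finite_induct)
    (auto intro: klr_free_carrier_add klr_free_carrier_zero)

lemma swap_seq_in: "i \<in> residue_seqs d \<Longrightarrow> swap_seq r i \<in> residue_seqs d"
  by (simp add: residue_seqs_def swap_seq_def)

lemma klr_rel_carrier:
  assumes "klr_rel kap d p q"
  shows "p \<in> carrier (klr_free d) \<and> q \<in> carrier (klr_free d)"
proof -
  have two: "2 * x \<in> carrier (klr_free d)"
    if "x \<in> carrier (klr_free d)" for x :: "'a klr_poly"
    using klr_free_carrier_add[OF that that] by (simp add: mult_2)
  note C = klr_free_carrier_mult klr_free_carrier_add klr_free_carrier_diff klr_free_carrier_one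
    klr_free_carrier_zero klr_free_carrier_power klr_free_carrier_sum gE_carrier gY_carrier
    gPsi_carrier swap_seq_in two
  from assms show ?thesis
    by cases (auto intro!: C)
qed

lemma klr_ideal_ideal: "ideal (klr_ideal kap d) (klr_free d :: ('f::field) klr_poly ring)"
  unfolding klr_ideal_def
  by (rule ring.genideal_ideal[OF klr_free_ring])
    (auto dest: klr_rel_carrier intro: klr_free_carrier_diff)

lemma klr_ring_ring: "ring (klr_ring kap d)"
  unfolding klr_ring_def by (rule ideal.quotient_is_ring[OF klr_ideal_ideal])

definition word_perm :: "nat list \<Rightarrow> nat \<Rightarrow> nat" where
  "word_perm rs = foldr (\<lambda>r w. transpose r (Suc r) \<circ> w) rs id"

definition reduced_expr :: "nat \<Rightarrow> (nat \<Rightarrow> nat) \<Rightarrow> nat list \<Rightarrow> bool" where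
  "reduced_expr d w rs \<longleftrightarrow> set rs \<subseteq> {1..<d} \<and> word_perm rs = w \<and>
    (\<forall>rs'. set rs' \<subseteq> {1..<d} \<and> word_perm rs' = w \<longrightarrow> length rs \<le> length rs')"

definition tab_perm :: "multipartition \<Rightarrow> tableau \<Rightarrow> nat \<Rightarrow> nat" where
  "tab_perm lam t = (THE w. w permutes {1..mp_size lam} \<and>
     (\<forall>N\<in>diagram lam. w (init_tab lam N) = t N))"

text \<open>The construction depends on a choice \<open>rex\<close> of reduced expressions, one for each standard
  tableau.\<close>

definition reduced_choice ::
    "nat \<Rightarrow> nat \<Rightarrow> (multipartition \<Rightarrow> tableau \<Rightarrow> nat list) \<Rightarrow> bool" where
  "reduced_choice l d rex \<longleftrightarrow> (\<forall>mu\<in>multipartitions l d. \<forall>t\<in>std_tableaux mu.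
     reduced_expr d (tab_perm mu t) (rex mu t))"

definition psi_word :: "nat list \<Rightarrow> ('f::field) klr_poly" where
  "psi_word rs = (\<Prod>r\<leftarrow>rs. gPsi r)"

definition y_exponent :: "bit list \<Rightarrow> multipartition \<Rightarrow> nat \<Rightarrow> nat" where
  "y_exponent kap lam r =
    card (addable_below kap (shape_upto lam (init_tab lam) r) (node_at lam (init_tab lam) r))"

definition y_elem :: "bit list \<Rightarrow> multipartition \<Rightarrow> ('f::field) klr_poly" where
  "y_elem kap lam = (\<Prod>r\<leftarrow>[1..<Suc (mp_size lam)]. gY r ^ y_exponent kap lam r)"

definition cell_elem :: "bit list \<Rightarrow> nat \<Rightarrow> (multipartition \<Rightarrow> tableau \<Rightarrow> nat list) \<Rightarrow>
    multipartition \<Rightarrow> tableau \<Rightarrow> tableau \<Rightarrow> ('f::field) klr_poly set" where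
  "cell_elem kap d rex lam s t =
    klr_class kap d (psi_word (rex lam s))
    \<otimes>\<^bsub>klr_alg kap d\<^esub> klr_class kap d (gE (res_seq kap lam (init_tab lam)))
    \<otimes>\<^bsub>klr_alg kap d\<^esub> klr_class kap d (y_elem kap lam)
    \<otimes>\<^bsub>klr_alg kap d\<^esub> klr_star (klr_class kap d (psi_word (rex lam t)))"

definition cell_ideal :: "bit list \<Rightarrow> nat \<Rightarrow> (multipartition \<Rightarrow> tableau \<Rightarrow> nat list) \<Rightarrow>
    multipartition \<Rightarrow> ('f::field) klr_poly set set" where
  "cell_ideal kap d rex lam = lin_span (klr_alg kap d)
    {cell_elem kap d rex mu s t | mu s t.
       mu \<in> multipartitions (length kap) d \<and> dominates mu lam \<and> mu \<noteq> lam \<and>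
       s \<in> std_tableaux mu \<and> t \<in> std_tableaux mu}"

record ('h, 'v) graded_module =
  gm_carrier :: "'v set"
  gm_component :: "int \<Rightarrow> 'v set"
  gm_action :: "'h \<Rightarrow> 'v \<Rightarrow> 'v"

definition pscale :: "'f::field \<Rightarrow> ('k \<Rightarrow>\<^sub>0 'f) \<Rightarrow> ('k \<Rightarrow>\<^sub>0 'f)" where
  "pscale c = Poly_Mapping.map ((*) c)"

lemma lookup_pscale: "Poly_Mapping.lookup (pscale c x) k = c * Poly_Mapping.lookup x k"
  by (simp add: pscale_def map.rep_eq when_def)

interpretation pm: vector_space pscale
  by standard
    (simp_all add: poly_mapping_eq_iff fun_eq_iff lookup_add lookup_pscale algebra_simps)

text \<open>\<open>specht_structure kap d rex lam h s\<close> is \<open>h z\<^sub>s\<close>: its coefficients \<open>r\<^sub>v\<close> are the structure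
  constants of left multiplication on the cellular basis modulo more dominant terms, which do not
  depend on \<open>t\<close>. Here \<open>z\<^sub>v\<close> is \<open>Poly_Mapping.single v 1\<close>.\<close>

definition specht_structure :: "bit list \<Rightarrow> nat \<Rightarrow> (multipartition \<Rightarrow> tableau \<Rightarrow> nat list) \<Rightarrow>
    multipartition \<Rightarrow> ('f::field) klr_poly set \<Rightarrow> tableau \<Rightarrow> (tableau \<Rightarrow>\<^sub>0 'f)" where
  "specht_structure kap d rex lam h s = (THE x. Poly_Mapping.keys x \<subseteq> std_tableaux lam \<and>
     (\<forall>t\<in>std_tableaux lam.
        (h \<otimes>\<^bsub>klr_alg kap d\<^esub> cell_elem kap d rex lam s t) \<ominus>\<^bsub>klr_alg kap d\<^esub>
        (\<Oplus>\<^bsub>klr_alg kap d\<^esub>v\<in>std_tableaux lam.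
           Poly_Mapping.lookup x v \<odot>\<^bsub>klr_alg kap d\<^esub> cell_elem kap d rex lam v t)
        \<in> cell_ideal kap d rex lam))"

type_synonym 'f specht_module = "('f klr_poly set, tableau \<Rightarrow>\<^sub>0 'f) graded_module"

definition specht :: "bit list \<Rightarrow> nat \<Rightarrow> (multipartition \<Rightarrow> tableau \<Rightarrow> nat list) \<Rightarrow>
    multipartition \<Rightarrow> ('f::field) specht_module" where
  "specht kap d rex lam =
    \<lparr>gm_carrier = pm.span {Poly_Mapping.single t 1 | t. t \<in> std_tableaux lam},
     gm_component =
       (\<lambda>n. pm.span {Poly_Mapping.single t 1 | t. t \<in> std_tableaux lam \<and> tab_deg kap lam t = n}),
     gm_action = (\<lambda>h x. \<Sum>s\<in>Poly_Mapping.keys x.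
        pscale (Poly_Mapping.lookup x s) (specht_structure kap d rex lam h s))\<rparr>"

text \<open>Integral Laurent polynomials are finitely supported functions \<open>int \<Rightarrow> int\<close> with the
  convolution product.\<close>

type_synonym laurent = "int \<Rightarrow>\<^sub>0 int"

definition q_var :: laurent where
  "q_var = Poly_Mapping.single 1 1"

definition qdim :: "('h, 'k \<Rightarrow>\<^sub>0 'f::field) graded_module \<Rightarrow> laurent" where
  "qdim M = (\<Sum>n | gm_component M n \<noteq> {0}.
     Poly_Mapping.single n (int (pm.dim (gm_component M n))))"

definition laurent_cong :: "laurent \<Rightarrow> laurent \<Rightarrow> bool" where
  "laurent_cong f g \<longleftrightarrow> (q_var ^ 2 - 1) dvd (f - g)"

lemma laurent_cong_add:
  "laurent_cong f f' \<Longrightarrow> laurent_cong g g' \<Longrightarrow> laurent_cong (f + g) (f' + g')"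
  using dvd_add[of "q_var ^ 2 - 1" "f - f'" "g - g'"] by (simp add: laurent_cong_def algebra_simps)

lemma laurent_cong_uminus: "laurent_cong f f' \<Longrightarrow> laurent_cong (- f) (- f')"
  using dvd_minus_iff[of "q_var ^ 2 - 1" "f - f'"] by (simp add: laurent_cong_def)

lemma laurent_cong_mult:
  assumes "laurent_cong f f'" "laurent_cong g g'"
  shows "laurent_cong (f * g) (f' * g')"
proof -
  have "f * g - f' * g' = (f - f') * g + f' * (g - g')"
    by (simp add: algebra_simps)
  then show ?thesis
    using assms unfolding laurent_cong_def by simp
qed

quotient_type laurent_u = laurent / laurent_cong
proof (rule equivpI)
  show "reflp laurent_cong" by (simp add: reflp_def laurent_cong_def)
  show "symp laurent_cong"
    using laurent_cong_uminus unfolding symp_def laurent_cong_def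
    by (metis dvd_minus_iff minus_diff_eq)
  show "transp laurent_cong"
  proof (rule transpI)
    fix f g h assume "laurent_cong f g" "laurent_cong g h"
    then show "laurent_cong f h"
      using dvd_add[of "q_var ^ 2 - 1" "f - g" "g - h"] by (simp add: laurent_cong_def)
  qed
qed

instantiation laurent_u :: comm_ring_1
begin

lift_definition zero_laurent_u :: laurent_u is 0 .
lift_definition one_laurent_u :: laurent_u is 1 .
lift_definition plus_laurent_u :: "laurent_u \<Rightarrow> laurent_u \<Rightarrow> laurent_u" is "(+)"
  by (rule laurent_cong_add)
lift_definition uminus_laurent_u :: "laurent_u \<Rightarrow> laurent_u" is uminus
  by (rule laurent_cong_uminus)
lift_definition minus_laurent_u :: "laurent_u \<Rightarrow> laurent_u \<Rightarrow> laurent_u" is "(-)"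
  using laurent_cong_add laurent_cong_uminus by (metis diff_conv_add_uminus)
lift_definition times_laurent_u :: "laurent_u \<Rightarrow> laurent_u \<Rightarrow> laurent_u" is "(*)"
  by (rule laurent_cong_mult)

lemma not_laurent_cong_0_1: "\<not> laurent_cong 0 1"
proof
  assume "laurent_cong 0 1"
  then obtain k where k: "- 1 = (q_var ^ 2 - 1) * k"
    unfolding laurent_cong_def dvd_def by (metis diff_0)
  define S :: "laurent \<Rightarrow> int" where "S p = (\<Sum>n\<in>Poly_Mapping.keys p. Poly_Mapping.lookup p n)" for p
  have S_eq: "S p = sum (Poly_Mapping.lookup p) A" if "finite A" "Poly_Mapping.keys p \<subseteq> A" for p A
    unfolding S_def using that by (intro sum.mono_neutral_left) (auto simp: in_keys_iff)
  have S_add: "S (p + r) = S p + S r" for p r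
  proof -
    let ?A = "Poly_Mapping.keys p \<union> Poly_Mapping.keys r"
    have "S (p + r) = sum (Poly_Mapping.lookup (p + r)) ?A"
      by (rule S_eq) (auto simp: keys_add)
    also have "\<dots> = sum (Poly_Mapping.lookup p) ?A + sum (Poly_Mapping.lookup r) ?A"
      by (simp add: lookup_add sum.distrib)
    finally show ?thesis by (simp add: S_eq[of ?A])
  qed
  have S_diff: "S (p - r) = S p - S r" for p r
    using S_add[of "p - r" r] by simp
  have S_single: "S (Poly_Mapping.single m 1 * p) = S p" for m p
  proof (rule frag_induction[where S = UNIV and c = p])
    fix a b assume "S (Poly_Mapping.single m 1 * a) = S a" "S (Poly_Mapping.single m 1 * b) = S b"
    then show "S (Poly_Mapping.single m 1 * (a - b)) = S (a - b)"
      by (simp add: right_diff_distrib S_diff)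
  qed (simp_all add: S_def mult_single)
  have "q_var ^ 2 * k = (q_var ^ 2 - 1) * k + Poly_Mapping.single 0 1 * k"
    by (simp add: algebra_simps)
  then have "S (Poly_Mapping.single 2 1 * k) = S (- 1 + Poly_Mapping.single 0 1 * k)"
    using k by (simp add: q_var_def power2_eq_square mult_single)
  then have "S (- 1) = 0"
    by (simp only: S_add S_single)
  moreover have "S (- 1) = - 1"
    by (simp add: S_def)
  ultimately show False by simp
qed

instance
  by standard
    (transfer, use not_laurent_cong_0_1 in \<open>simp add: laurent_cong_def algebra_simps\<close>)+

end

text \<open>\<open>laurent_at_u f\<close> is \<open>f(u)\<close>, the image of \<open>f\<close> in the quotient ring.\<close>

definition laurent_at_u :: "laurent \<Rightarrow> laurent_u" where
  "laurent_at_u f = abs_laurent_u f"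

definition u_elt :: laurent_u where
  "u_elt = laurent_at_u q_var"

definition u_pow :: "bit \<Rightarrow> laurent_u" where
  "u_pow m = (if m = 0 then 1 else u_elt)"

lemma u_elt_square: "u_elt ^ 2 = 1"
  by (simp add: u_elt_def laurent_at_u_def power2_eq_square times_laurent_u.abs_eq
      one_laurent_u.abs_eq laurent_u.abs_eq_iff laurent_cong_def)

lemma u_pow_of_nat: "u_pow (of_nat n) = u_elt ^ n"
proof (induction n)
  case 0
  then show ?case by (simp add: u_pow_def)
next
  case (Suc n)
  have "u_pow (1 + m) = u_elt * u_pow m" for m
    using u_elt_square by (cases m) (simp_all add: u_pow_def power2_eq_square)
  then show ?case using Suc by simp
qed

end

theory Submission
  imports Defs
begin

text \<open>
  The graded dimension counts standard tableaux by degree, so it suffices that every standard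
  tableau has degree of parity \<open>\<epsilon>(\<lambda>)\<close>. Both sides are sums over the nodes of the diagram of one
  local weight: a node \<open>(a, b, m)\<close> contributes \<open>1\<close> for even \<open>b\<close>, plus \<open>1\<close> for each later component
  whose charge is its residue. For the degree this is a telescoping count of the addable and
  removable nodes below a removable node.
\<close>

text \<open>These rules would rewrite sums in \<open>bit\<close> into boolean connectives and cardinalities.\<close>

declare add_bit_eq_xor [simp del] sum_of_bool_eq [simp del]

section \<open>Young diagrams as closed sets of nodes\<close>

text \<open>Intrinsic counterpart of \<open>is_diagram\<close>, which only asserts that some
  multipartition exists. The guards \<open>1 \<le> b\<close> and \<open>1 \<le> a\<close> stop the
  closure at the first column and the first row, since nodes are numbered from 1.\<close>

definition young :: "nat \<Rightarrow> node set \<Rightarrow> bool" where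
  "young l X \<longleftrightarrow> finite X \<and>
    (\<forall>a b m. (a, b, m) \<in> X \<longrightarrow> 1 \<le> m \<and> m \<le> l \<and> 1 \<le> a \<and> 1 \<le> b) \<and>
    (\<forall>a b m. (a, Suc b, m) \<in> X \<longrightarrow> 1 \<le> b \<longrightarrow> (a, b, m) \<in> X) \<and>
    (\<forall>a b m. (Suc a, b, m) \<in> X \<longrightarrow> 1 \<le> a \<longrightarrow> (a, b, m) \<in> X)"

lemma youngI:
  assumes "finite X" "\<And>a b m. (a, b, m) \<in> X \<Longrightarrow> 1 \<le> m \<and> m \<le> l \<and> 1 \<le> a \<and> 1 \<le> b"
    and "\<And>a b m. (a, Suc b, m) \<in> X \<Longrightarrow> 1 \<le> b \<Longrightarrow> (a, b, m) \<in> X"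
    and "\<And>a b m. (Suc a, b, m) \<in> X \<Longrightarrow> 1 \<le> a \<Longrightarrow> (a, b, m) \<in> X"
  shows "young l X"
  unfolding young_def using assms by blast

lemma young_finite: "young l X \<Longrightarrow> finite X"
  by (simp only: young_def)

lemma young_pos:
  assumes "young l X" "(a, b, m) \<in> X"
  shows "1 \<le> m" "m \<le> l" "1 \<le> a" "1 \<le> b"
  using assms unfolding young_def by blast+

lemma young_left: "young l X \<Longrightarrow> (a, Suc b, m) \<in> X \<Longrightarrow> 1 \<le> b \<Longrightarrow> (a, b, m) \<in> X"
  unfolding young_def by blast

lemma young_up: "young l X \<Longrightarrow> (Suc a, b, m) \<in> X \<Longrightarrow> 1 \<le> a \<Longrightarrow> (a, b, m) \<in> X"
  unfolding young_def by blast

definition row_len :: "node set \<Rightarrow> nat \<Rightarrow> nat \<Rightarrow> nat" where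
  "row_len X m a = card {b. (a, b, m) \<in> X}"

text \<open>Descending from \<open>Max B\<close> one step at a time reaches every positive number
  below it, so \<open>B\<close> is \<open>{1..Max B}\<close> and counting gives
  \<open>Max B = card B\<close>. Applied below to rows and to first columns.\<close>

lemma down_closed_nat_eq:
  fixes B :: "nat set"
  assumes "finite B" "0 \<notin> B" "\<And>b. Suc b \<in> B \<Longrightarrow> 1 \<le> b \<Longrightarrow> b \<in> B"
  shows "B = {1..card B}"
proof (cases "B = {}")
  case False
  have down: "c \<in> B" if "c + k \<in> B" "1 \<le> c" for c k
    using that
  proof (induction k)
    case (Suc k)
    then show ?case using assms(3)[of "c + k"] by simp
  qed simp
  have "c \<in> B" if "c \<in> {1..Max B}" for c
    using down[of c "Max B - c"] that Max_in[OF assms(1) False] by simp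
  moreover have "c \<in> {1..Max B}" if "c \<in> B" for c
    using that assms(1,2) by (cases c) auto
  ultimately have "B = {1..Max B}" by blast
  then show ?thesis by (metis card_atLeastAtMost diff_Suc_1)
qed simp

text \<open>Rows are finite and closed to the left, hence initial segments. Membership can thus be
  traded for inequalities between row lengths.\<close>

lemma young_mem_iff:
  assumes "young l X"
  shows "(a, b, m) \<in> X \<longleftrightarrow> 1 \<le> b \<and> b \<le> row_len X m a"
proof -
  have "{b. (a, b, m) \<in> X} \<subseteq> (\<lambda>(a, b, m). b) ` X" by force
  then have "finite {b. (a, b, m) \<in> X}"
    using young_finite[OF assms] by (meson finite_imageI finite_subset)
  then have "{b. (a, b, m) \<in> X} = {1..row_len X m a}"
    unfolding row_len_def
    by (intro down_closed_nat_eq) (auto dest: young_pos(4)[OF assms] intro: young_left[OF assms])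
  then show ?thesis by auto
qed

lemma row_len_Suc_le:
  assumes "young l X" "1 \<le> a"
  shows "row_len X m (Suc a) \<le> row_len X m a"
proof (cases "row_len X m (Suc a) = 0")
  case False
  then have "(Suc a, row_len X m (Suc a), m) \<in> X"
    using young_mem_iff[OF assms(1)] by simp
  then show ?thesis
    using young_up[OF assms(1)] assms(2) young_mem_iff[OF assms(1)] by blast
qed simp

text \<open>A finite set has a largest row index. The bound is uniform in the component, so that
  sums over rows can later share one upper limit.\<close>

lemma young_row_bound:
  assumes "young l X"
  obtains n where "\<And>m a. n < a \<Longrightarrow> row_len X m a = 0"
proof -
  have "finite (fst ` X)" using young_finite[OF assms] by simp
  then obtain n where n: "\<And>x. x \<in> fst ` X \<Longrightarrow> x \<le> n"
    by (meson finite_nat_set_iff_bounded_le)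
  have "row_len X m a = 0" if "n < a" for m a
  proof (rule ccontr)
    assume "row_len X m a \<noteq> 0"
    then have "(a, 1, m) \<in> X" using young_mem_iff[OF assms] by simp
    then show False using n[of a] that by force
  qed
  then show thesis using that by blast
qed

lemma partition_part_le:
  assumes "is_partition nu" "1 \<le> a"
  shows "part nu (Suc a) \<le> part nu a"
  using assms sorted_wrt_nth_less[of "(\<ge>)" nu "a - 1" a]
  by (auto simp: part_def is_partition_def)

text \<open>Renumbering rows and components from 0 exhibits the diagram as an image of a finite
  dependent sum, whence its finiteness.\<close>

lemma diagram_conv_Sigma:
  "diagram lam = (\<lambda>(m, a, b). (Suc a, b, Suc m)) `
     (SIGMA m:{..<length lam}. SIGMA a:{..<length (lam ! m)}. {1..lam ! m ! a})"
proof -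
  have "(a, b, m) \<in> (\<lambda>(m, a, b). (Suc a, b, Suc m)) `
     (SIGMA m:{..<length lam}. SIGMA a:{..<length (lam ! m)}. {1..lam ! m ! a})"
    if "(a, b, m) \<in> diagram lam" for a b m
    using that
    by (intro image_eqI[where x = "(m - 1, a - 1, b)"])
      (auto simp: diagram_def part_def split: if_splits)
  then show ?thesis by (auto simp: diagram_def part_def)
qed

lemma finite_diagram: "finite (diagram lam)"
  by (subst diagram_conv_Sigma) auto

lemma young_diagram:
  assumes "lam \<in> multipartitions l d"
  shows "young l (diagram lam)"
proof -
  have len: "length lam = l" and P: "\<And>m. m < l \<Longrightarrow> is_partition (lam ! m)"
    using assms by (auto simp: multipartitions_def)
  have "b \<le> part (lam ! (m - Suc 0)) a"
    if "m \<le> l" "Suc 0 \<le> m" "Suc 0 \<le> a" "b \<le> part (lam ! (m - Suc 0)) (Suc a)" for a b m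
  proof -
    have "m - Suc 0 < l" using that by linarith
    then show ?thesis using partition_part_le[OF P, of "m - Suc 0" a] that by simp
  qed
  then show ?thesis
    using len finite_diagram[of lam] by (intro youngI) (auto simp: diagram_def)
qed

lemma young_imp_is_diagram:
  assumes Y: "young l X"
  shows "is_diagram l X"
proof -
  \<comment> \<open>The length of the first column is the number of nonempty rows of component
    \<open>m\<close>. Cutting the list of row lengths there keeps zeros out of it, as
    \<open>is_partition\<close> demands.\<close>
  define h where "h m = card {a. (a, 1, m) \<in> X}" for m
  have h: "{a. (a, 1, m) \<in> X} = {1..h m}" for m
  proof -
    have "{a. (a, 1, m) \<in> X} \<subseteq> fst ` X" by force
    then have "finite {a. (a, 1, m) \<in> X}"
      using young_finite[OF Y] by (meson finite_imageI finite_subset)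
    then show ?thesis
      unfolding h_def
      by (intro down_closed_nat_eq) (auto dest: young_pos(3)[OF Y] intro: young_up[OF Y])
  qed
  have pos: "1 \<le> row_len X m a \<longleftrightarrow> 1 \<le> a \<and> a \<le> h m" for m a
    using h[of m] young_mem_iff[OF Y, of a 1 m] by auto
  define lam where "lam = map (\<lambda>m. map (row_len X m) [1..<Suc (h m)]) [1..<Suc l]"
  have part: "part (lam ! (m - 1)) a = row_len X m a" if "1 \<le> m" "m \<le> l" "1 \<le> a" for m a
  proof (cases "a \<le> h m")
    \<comment> \<open>Beyond the last nonempty row, the default value 0 of \<open>part\<close>
      agrees with the length of an empty row.\<close>
    case False
    then have "row_len X m a = 0" using pos[of m a] by auto
    then show ?thesis using False that by (simp add: lam_def part_def del: upt_Suc)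
  qed (use that in \<open>simp add: lam_def part_def del: upt_Suc\<close>)
  have "is_partition (map (row_len X m) [1..<Suc (h m)])" for m
  proof -
    have anti: "row_len X m (a + k) \<le> row_len X m a" if "1 \<le> a" for a k
    proof (induction k)
      case (Suc k)
      then show ?case using row_len_Suc_le[OF Y, of "a + k" m] that by simp
    qed simp
    have "row_len X m b \<le> row_len X m a" if "1 \<le> a" "a < b" for a b
      using anti[of a "b - a"] that by simp
    then have "sorted_wrt (\<ge>) (map (row_len X m) [1..<Suc (h m)])"
      by (auto simp: sorted_wrt_iff_nth_less simp del: upt_Suc)
    moreover have "0 \<notin> set (map (row_len X m) [1..<Suc (h m)])"
    proof
      assume "0 \<in> set (map (row_len X m) [1..<Suc (h m)])"
      then obtain a where a: "a \<in> {1..<Suc (h m)}" "row_len X m a = 0"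
        by (metis imageE list.set_map set_upt)
      then show False using pos[of m a] by simp
    qed
    ultimately show ?thesis by (simp add: is_partition_def)
  qed
  then have "lam \<in> multipartitions l (mp_size lam)"
    by (auto simp: multipartitions_def lam_def simp del: upt_Suc)
  moreover have "(a, b, m) \<in> diagram lam \<longleftrightarrow> (a, b, m) \<in> X" for a b m
  proof (cases "1 \<le> m \<and> m \<le> l \<and> 1 \<le> a")
    case True
    then show ?thesis
      using part[of m a] young_mem_iff[OF Y, of a b m] by (simp add: diagram_def lam_def)
  next
    case False
    then show ?thesis using young_pos[OF Y, of a b m] by (auto simp: diagram_def lam_def)
  qed
  then have "X = diagram lam" by auto
  ultimately show ?thesis by (auto simp: is_diagram_def)
qed

lemma is_diagram_iff_young: "is_diagram l X \<longleftrightarrow> young l X"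
  using young_imp_is_diagram young_diagram by (auto simp: is_diagram_def)

section \<open>Addable and removable nodes in terms of row lengths\<close>

text \<open>The new node is missing from its row while its left neighbour, if any, is present, which
  fixes the column. Closure upwards then forces the row above, if any, to be strictly
  longer.\<close>

lemma addable_iff:
  assumes Y: "young l X"
  shows "addable l X (a, b, m) \<longleftrightarrow> 1 \<le> m \<and> m \<le> l \<and> 1 \<le> a \<and>
    b = Suc (row_len X m a) \<and> (a = 1 \<or> row_len X m a < row_len X m (a - 1))"
    (is "?L \<longleftrightarrow> ?R")
proof
  assume ?L
  then have N: "(a, b, m) \<notin> X" and Z: "young l (insert (a, b, m) X)"
    by (auto simp: addable_def is_diagram_iff_young)
  note pos = young_pos[OF Z insertI1]
  have "b > row_len X m a" using N young_mem_iff[OF Y, of a b m] pos by auto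
  moreover have "b - 1 \<le> row_len X m a"
  proof (cases "b = 1")
    case False
    then obtain b' where b': "b = Suc b'" "1 \<le> b'" using pos(4) by (cases b) auto
    then have "(a, b', m) \<in> X" using young_left[OF Z, of a b' m] by simp
    then show ?thesis using young_mem_iff[OF Y, of a b' m] b' by simp
  qed simp
  ultimately have b: "b = Suc (row_len X m a)" by linarith
  have "b \<le> row_len X m (a - 1)" if ne: "a \<noteq> 1"
  proof -
    obtain a' where a': "a = Suc a'" "1 \<le> a'" using pos(3) ne by (cases a) auto
    then have "(a', b, m) \<in> X" using young_up[OF Z, of a' b m] by simp
    then show ?thesis using young_mem_iff[OF Y, of a' b m] a' by simp
  qed
  then show ?R using pos b by (cases "a = 1") auto
next
  assume R: ?R
  then have "(a, b, m) \<notin> X" using young_mem_iff[OF Y] by simp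
  moreover have "young l (insert (a, b, m) X)"
  proof (rule youngI)
    show "finite (insert (a, b, m) X)" using young_finite[OF Y] by simp
  next
    fix a' b' m' assume "(a', b', m') \<in> insert (a, b, m) X"
    then show "1 \<le> m' \<and> m' \<le> l \<and> 1 \<le> a' \<and> 1 \<le> b'"
      using R young_pos[OF Y, of a' b' m'] by auto
  next
    fix a' b' m' assume "(a', Suc b', m') \<in> insert (a, b, m) X" "1 \<le> b'"
    then show "(a', b', m') \<in> insert (a, b, m) X"
      using R by (auto simp: young_mem_iff[OF Y])
  next
    fix a' b' m' assume "(Suc a', b', m') \<in> insert (a, b, m) X" "1 \<le> a'"
    then show "(a', b', m') \<in> insert (a, b, m) X"
      using R young_up[OF Y, of a' b' m'] by (auto simp: young_mem_iff[OF Y])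
  qed
  ultimately show ?L by (simp add: addable_def is_diagram_iff_young)
qed

text \<open>Deleting a node preserves closure exactly when its right and lower neighbours are
  absent.\<close>

lemma removable_iff:
  assumes Y: "young l X"
  shows "removable l X (a, b, m) \<longleftrightarrow> 1 \<le> m \<and> m \<le> l \<and> 1 \<le> a \<and>
    b = row_len X m a \<and> row_len X m (Suc a) < row_len X m a"
    (is "?L \<longleftrightarrow> ?R")
proof
  assume ?L
  then have N: "(a, b, m) \<in> X" and Z: "young l (X - {(a, b, m)})"
    by (auto simp: removable_def is_diagram_iff_young)
  note pos = young_pos[OF Y N]
  have "(a, Suc b, m) \<notin> X" "(Suc a, b, m) \<notin> X"
    using young_left[OF Z, of a b m] young_up[OF Z, of a b m] pos by auto
  then show ?R
    using N pos by (auto simp: young_mem_iff[OF Y])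
next
  assume R: ?R
  then have "(a, b, m) \<in> X" using young_mem_iff[OF Y] by simp
  moreover have "young l (X - {(a, b, m)})"
  proof (rule youngI)
    show "finite (X - {(a, b, m)})" using young_finite[OF Y] by simp
  next
    fix a' b' m' assume "(a', b', m') \<in> X - {(a, b, m)}"
    then show "1 \<le> m' \<and> m' \<le> l \<and> 1 \<le> a' \<and> 1 \<le> b'"
      using young_pos[OF Y, of a' b' m'] by simp
  next
    fix a' b' m' assume "(a', Suc b', m') \<in> X - {(a, b, m)}" "1 \<le> b'"
    then show "(a', b', m') \<in> X - {(a, b, m)}"
      using R by (auto simp: young_mem_iff[OF Y])
  next
    fix a' b' m' assume "(Suc a', b', m') \<in> X - {(a, b, m)}" "1 \<le> a'"
    then show "(a', b', m') \<in> X - {(a, b, m)}"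
      using R young_up[OF Y, of a' b' m'] by (auto simp: young_mem_iff[OF Y])
  qed
  ultimately show ?L by (simp add: removable_def is_diagram_iff_young)
qed

section \<open>Counting modulo 2\<close>

lemma of_nat_bit: "(of_nat n :: bit) = of_bool (odd n)"
  by (induction n) auto

text \<open>In \<open>bit\<close> the indicator of \<open>z = i\<close> is \<open>z + i + 1\<close>.
  Adding two of these cancels \<open>k\<close>, \<open>c\<close>, \<open>i\<close> and the
  constant.\<close>

lemma of_bool_eq_add_bit: "of_bool (k + x + c = i) + of_bool (k + y + c = i) = (x + y :: bit)"
  by (cases k; cases x; cases y; cases c; cases i) simp_all

lemma add_cancel_bit: "x + y + (y + z) = (x + z :: bit)"
  by (cases x; cases y; cases z) simp_all

lemma of_nat_card_bit:
  "finite A \<Longrightarrow> (of_nat (card {x \<in> A. P x}) :: bit) = (\<Sum>x\<in>A. of_bool (P x))"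
  by (simp add: sum_of_bool_eq Int_def)

text \<open>Addition is also subtraction in \<open>bit\<close>, so sums of consecutive values
  telescope.\<close>

lemma bit_telescope:
  fixes f :: "nat \<Rightarrow> bit"
  assumes "a \<le> n"
  shows "(\<Sum>c\<in>{a<..n}. f (Suc c) + f c) = f (Suc n) + f (Suc a)"
  using assms
proof (induction rule: dec_induct)
  case (step n)
  have "{a<..Suc n} = insert (Suc n) {a<..n}" using step by auto
  then have "(\<Sum>c\<in>{a<..Suc n}. f (Suc c) + f c) =
      f (Suc (Suc n)) + f (Suc n) + (\<Sum>c\<in>{a<..n}. f (Suc c) + f c)"
    by (simp only:) (rule sum.insert, simp_all)
  then show ?case by (simp only: step.IH add_cancel_bit)
qed simp

text \<open>Row \<open>Suc c\<close> has an addable node exactly when row \<open>c\<close> has a removable one. Pairing the two,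
  the indicators of the residue \<open>i\<close> add up to \<open>f (Suc c) + f c\<close> in \<open>bit\<close>, which also vanishes
  when the two rows have equal length.\<close>

lemma addable_removable_rows_parity:
  fixes f :: "nat \<Rightarrow> nat" and k i :: bit
  assumes "a \<le> n" "f (Suc n) = 0" "\<And>c. a < c \<Longrightarrow> f (Suc c) \<le> f c"
  shows "(\<Sum>c\<in>{a..n}. of_bool ((c = a \<or> f (Suc c) < f c) \<and> k + of_nat (f (Suc c)) + of_nat c = i)) +
    (\<Sum>c\<in>{a<..n}. of_bool (f (Suc c) < f c \<and> k + of_nat (f c) + of_nat c = i)) =
    (of_bool (k + of_nat a = i) :: bit)"
proof -
  have ins: "{a..n} = insert a {a<..n}" using assms(1) by auto
  have pair: "of_bool ((c = a \<or> f (Suc c) < f c) \<and> k + of_nat (f (Suc c)) + of_nat c = i) +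
      of_bool (f (Suc c) < f c \<and> k + of_nat (f c) + of_nat c = i)
    = (of_nat (f (Suc c)) + of_nat (f c) :: bit)" if "c \<in> {a<..n}" for c
  proof (cases "f (Suc c) < f c")
    case True
    then show ?thesis by (simp only: simp_thms of_bool_eq_add_bit)
  next
    case False
    then have "f (Suc c) = f c" using assms(3)[of c] that by simp
    then show ?thesis using that by simp
  qed
  have tail: "(\<Sum>c\<in>{a<..n}. of_bool ((c = a \<or> f (Suc c) < f c) \<and> k + of_nat (f (Suc c)) + of_nat c = i)) +
      (\<Sum>c\<in>{a<..n}. of_bool (f (Suc c) < f c \<and> k + of_nat (f c) + of_nat c = i))
    = (of_nat (f (Suc a)) :: bit)"
    using bit_telescope[OF assms(1), of "\<lambda>c. of_nat (f c)"] assms(2)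
      sum.cong[OF refl pair, of "{a<..n}" "\<lambda>c. c"]
    by (simp add: sum.distrib)
  \<comment> \<open>The addable term at \<open>c = a\<close> has no removable partner. The
    telescoped remainder \<open>f (Suc a)\<close> cancels the row length inside its residue
    condition, leaving a test that no longer involves \<open>f\<close>.\<close>
  have "of_bool (k + x + c = i) + x = (of_bool (k + c = i) :: bit)" for x c
    by (cases k; cases x; cases c; cases i) simp_all
  then show ?thesis
    using tail by (simp add: ins add.assoc)
qed

section \<open>The parity of the degree of a node\<close>

definition node_weight :: "bit list \<Rightarrow> node \<Rightarrow> bit" where
  "node_weight kap N = (case N of (a, b, m) \<Rightarrow>
     of_bool (even b) + (\<Sum>m'\<in>{m<..length kap}. of_bool (node_res kap N = kap ! (m' - 1))))"

lemma node_res_bit: "node_res kap (a, b, m) = kap ! (m - 1) + of_nat b + of_nat a"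
proof -
  have "x - y = x + y" for x y :: bit by simp
  then show ?thesis by (simp only: node_res_def prod.case of_int_diff of_int_of_nat_eq add.assoc)
qed

text \<open>In each component the addable and removable nodes below \<open>N\<close> cancel up to a
  single indicator. What remains depends on \<open>N\<close> and the charges only, not on the rest
  of \<open>X\<close>.\<close>

lemma node_deg_parity:
  assumes Y: "young (length kap) X" and N: "removable (length kap) X N"
  shows "of_int (node_deg kap X N) = node_weight kap N"
proof -
  obtain a b m where N_eq: "N = (a, b, m)" by (cases N)
  obtain n0 where n0: "\<And>m a. n0 < a \<Longrightarrow> row_len X m a = 0"
    using young_row_bound[OF Y] by blast
  define l where "l = length kap"
  \<comment> \<open>At least \<open>n0\<close>, so that all later rows are empty; at least
    \<open>a\<close>, so that the row ranges starting at \<open>a\<close> are proper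
    intervals.\<close>
  define n where "n = max n0 a"
  define i where "i = node_res kap N"
  let ?f = "row_len X"
  have n: "?f m a = 0" if "n < a" for m a using n0 that by (simp add: n_def)
  have R: "1 \<le> m" "m \<le> l" "1 \<le> a" "b = ?f m a" "?f m (Suc a) < ?f m a"
    using N removable_iff[OF Y] by (auto simp: N_eq l_def)
  \<comment> \<open>The rows of component \<open>m'\<close> that lie below \<open>N\<close> are those after row \<open>s m'\<close>.\<close>
  define s where "s m' = (if m' = m then a else 0)" for m'
  \<comment> \<open>The addable node meant here lies in row \<open>Suc c\<close> and column
    \<open>Suc (?f m' (Suc c))\<close>; the two successors cancel modulo 2 in its residue. Row
    \<open>Suc (s m')\<close> always admits a node: it is the first row of a later component, or the
    row under the removable node \<open>N\<close>.\<close>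
  define PA where "PA m' c \<longleftrightarrow> (c = s m' \<or> ?f m' (Suc c) < ?f m' c) \<and>
    kap ! (m' - 1) + of_nat (?f m' (Suc c)) + of_nat c = i" for m' c
  define PR where "PR m' c \<longleftrightarrow> ?f m' (Suc c) < ?f m' c \<and>
    kap ! (m' - 1) + of_nat (?f m' c) + of_nat c = i" for m' c
  have "addable_below kap X N =
      (\<lambda>(m', c). (Suc c, Suc (?f m' (Suc c)), m')) ` {p \<in> (SIGMA m':{m..l}. {s m'..n}). case_prod PA p}"
    (is "_ = ?g ` ?A")
  proof (intro equalityI subsetI)
    fix A assume A: "A \<in> addable_below kap X N"
    obtain a' b' m' where A_eq: "A = (a', b', m')" by (cases A)
    have A': "1 \<le> m'" "m' \<le> l" "1 \<le> a'" "b' = Suc (?f m' a')"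
        "a' = 1 \<or> ?f m' a' < ?f m' (a' - 1)" "node_res kap (a', b', m') = i"
        "m < m' \<or> m' = m \<and> a < a'"
      using A by (auto simp: addable_below_def addable_iff[OF Y] A_eq l_def i_def below_def N_eq)
    obtain c where c: "a' = Suc c" using A'(3) by (cases a') auto
    have "c \<le> n" using A'(5) n[of c m'] by (cases "n < c") (auto simp: c)
    then have "(m', c) \<in> ?A"
      using A' by (auto simp: PA_def s_def c node_res_bit algebra_simps)
    then show "A \<in> ?g ` ?A" by (rule rev_image_eqI) (use A' in \<open>simp add: A_eq c\<close>)
  next
    fix A assume "A \<in> ?g ` ?A"
    then obtain m' c where A_eq: "A = (Suc c, Suc (?f m' (Suc c)), m')"
      and mc: "m \<le> m'" "m' \<le> l" "s m' \<le> c" "c \<le> n" "PA m' c" by auto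
    then show "A \<in> addable_below kap X N"
      using R by (auto simp: addable_below_def addable_iff[OF Y] l_def i_def below_def N_eq s_def
        PA_def node_res_bit algebra_simps split: if_splits)
  qed
  moreover have "inj_on (\<lambda>(m', c). (Suc c, Suc (?f m' (Suc c)), m')) Z" for Z
    by (auto simp: inj_on_def)
  ultimately have "card (addable_below kap X N) = card {p \<in> (SIGMA m':{m..l}. {s m'..n}). case_prod PA p}"
    by (simp only: card_image)
  then have cardA: "of_nat (card (addable_below kap X N)) =
      (\<Sum>m'\<in>{m..l}. \<Sum>c\<in>{s m'..n}. of_bool (PA m' c) :: bit)"
    by (simp add: of_nat_card_bit sum.Sigma case_prod_unfold)
  \<comment> \<open>Here \<open>c\<close> is the row itself, so it starts strictly after
    \<open>s m'\<close>, whereas for addable nodes, which lie in row \<open>Suc c\<close>, it starts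
    at \<open>s m'\<close>.\<close>
  have "removable_below kap X N =
      (\<lambda>(m', c). (c, ?f m' c, m')) ` {p \<in> (SIGMA m':{m..l}. {s m'<..n}). case_prod PR p}"
    (is "_ = ?g ` ?A")
  proof (intro equalityI subsetI)
    fix A assume A: "A \<in> removable_below kap X N"
    obtain c b' m' where A_eq: "A = (c, b', m')" by (cases A)
    have A': "1 \<le> m'" "m' \<le> l" "1 \<le> c" "b' = ?f m' c"
        "?f m' (Suc c) < ?f m' c" "node_res kap (c, b', m') = i"
        "m < m' \<or> m' = m \<and> a < c"
      using A by (auto simp: removable_below_def removable_iff[OF Y] A_eq l_def i_def below_def N_eq)
    have "c \<le> n" using A'(5) n[of c m'] by (cases "n < c") auto
    then have "(m', c) \<in> ?A"
      using A' by (auto simp: PR_def s_def node_res_bit algebra_simps)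
    then show "A \<in> ?g ` ?A" by (rule rev_image_eqI) (use A' in \<open>simp add: A_eq\<close>)
  next
    fix A assume "A \<in> ?g ` ?A"
    then obtain m' c where A_eq: "A = (c, ?f m' c, m')"
      and mc: "m \<le> m'" "m' \<le> l" "s m' < c" "c \<le> n" "PR m' c" by auto
    then show "A \<in> removable_below kap X N"
      using R by (auto simp: removable_below_def removable_iff[OF Y] l_def i_def below_def N_eq s_def
        PR_def node_res_bit algebra_simps split: if_splits)
  qed
  moreover have "inj_on (\<lambda>(m', c). (c, ?f m' c, m')) Z" for Z
    by (auto simp: inj_on_def)
  ultimately have "card (removable_below kap X N) = card {p \<in> (SIGMA m':{m..l}. {s m'<..n}). case_prod PR p}"
    by (simp only: card_image)
  then have cardR: "of_nat (card (removable_below kap X N)) =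
      (\<Sum>m'\<in>{m..l}. \<Sum>c\<in>{s m'<..n}. of_bool (PR m' c) :: bit)"
    by (simp add: of_nat_card_bit sum.Sigma case_prod_unfold)
  have "of_int (node_deg kap X N) = (\<Sum>m'\<in>{m..l}. (\<Sum>c\<in>{s m'..n}. of_bool (PA m' c)) +
      (\<Sum>c\<in>{s m'<..n}. of_bool (PR m' c)) :: bit)"
    by (simp add: node_deg_def cardA cardR sum.distrib)
  also have "\<dots> = (\<Sum>m'\<in>{m..l}. of_bool (kap ! (m' - 1) + of_nat (s m') = i))"
  proof (rule sum.cong)
    fix m' assume "m' \<in> {m..l}"
    have "s m' \<le> n" by (simp add: s_def n_def)
    then show "(\<Sum>c\<in>{s m'..n}. of_bool (PA m' c)) + (\<Sum>c\<in>{s m'<..n}. of_bool (PR m' c)) =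
        (of_bool (kap ! (m' - 1) + of_nat (s m') = i) :: bit)"
      unfolding PA_def PR_def
      by (intro addable_removable_rows_parity) (auto intro!: n row_len_Suc_le[OF Y])
  qed simp
  also have "{m..l} = insert m {m<..l}" using R(2) by auto
  also have "(\<Sum>m'\<in>insert m {m<..l}. of_bool (kap ! (m' - 1) + of_nat (s m') = i)) =
      (of_bool (kap ! (m - 1) + of_nat a = i) + (\<Sum>m'\<in>{m<..l}. of_bool (kap ! (m' - 1) = i)) :: bit)"
    by (simp add: s_def)
  \<comment> \<open>The residue \<open>i\<close> of \<open>N\<close> is the left side plus
    \<open>of_nat b\<close>, so the test for its own component only sees the parity of the
    column.\<close>
  also have "kap ! (m - 1) + of_nat a = i \<longleftrightarrow> even b"
    by (cases "even b"; cases "kap ! (m - 1)"; cases "even a")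
      (simp_all add: i_def N_eq node_res_bit of_nat_bit)
  finally show ?thesis
    by (simp add: node_weight_def N_eq i_def l_def eq_commute)
qed

section \<open>The parity of the degree of a standard tableau\<close>

text \<open>Entries increase to the right and downwards, so bounding them by \<open>r\<close> cuts
  out a set closed to the left and upwards.\<close>

lemma young_shape_upto:
  assumes lam: "lam \<in> multipartitions l d" and t: "t \<in> std_tableaux lam"
  shows "young l (shape_upto lam t r)"
proof -
  have Y: "young l (diagram lam)" using young_diagram[OF lam] .
  have row: "t (a, b, m) < t (a, Suc b, m)" if "(a, Suc b, m) \<in> diagram lam" "1 \<le> b" for a b m
    using t young_left[OF Y that] that unfolding std_tableaux_def by blast
  have col: "t (a, b, m) < t (Suc a, b, m)" if "(Suc a, b, m) \<in> diagram lam" "1 \<le> a" for a b m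
    using t young_up[OF Y that] that unfolding std_tableaux_def by blast
  show ?thesis
  proof (rule youngI)
    show "finite (shape_upto lam t r)" using finite_diagram by (simp add: shape_upto_def)
  next
    fix a b m assume "(a, b, m) \<in> shape_upto lam t r"
    then show "1 \<le> m \<and> m \<le> l \<and> 1 \<le> a \<and> 1 \<le> b"
      using young_pos[OF Y, of a b m] by (simp add: shape_upto_def)
  next
    fix a b m assume "(a, Suc b, m) \<in> shape_upto lam t r" "1 \<le> b"
    then show "(a, b, m) \<in> shape_upto lam t r"
      using row[of a b m] young_left[OF Y, of a b m] by (simp add: shape_upto_def)
  next
    fix a b m assume "(Suc a, b, m) \<in> shape_upto lam t r" "1 \<le> a"
    then show "(a, b, m) \<in> shape_upto lam t r"
      using col[of a b m] young_up[OF Y, of a b m] by (simp add: shape_upto_def)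
  qed
qed

text \<open>Each entry adds one node, which is removable from the enlarged shape, and so contributes
  its weight. The bound on \<open>r\<close> ensures that \<open>node_at\<close> inverts the tableau
  at an actual entry.\<close>

lemma deg_upto_parity:
  assumes lam: "lam \<in> multipartitions (length kap) d" and t: "t \<in> std_tableaux lam"
    and "r \<le> mp_size lam"
  shows "of_int (deg_upto kap lam t r) = (\<Sum>N\<in>shape_upto lam t r. node_weight kap N)"
  using assms(3)
proof (induction r)
  case 0
  have "bij_betw t (diagram lam) {1..mp_size lam}"
    using t by (simp add: std_tableaux_def tableaux_def)
  then have "shape_upto lam t 0 = {}"
    by (force simp: shape_upto_def dest: bij_betwE)
  then show ?case by simp
next
  case (Suc r)
  have bij: "bij_betw t (diagram lam) {1..mp_size lam}"
    using t by (simp add: std_tableaux_def tableaux_def)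
  define N where "N = node_at lam t (Suc r)"
  have img: "Suc r \<in> t ` diagram lam"
    using bij Suc.prems by (simp add: bij_betw_def)
  have N: "N \<in> diagram lam" "t N = Suc r"
    unfolding N_def node_at_def using inv_into_into[OF img] f_inv_into_f[OF img] by auto
  have uniq: "M = N" if "M \<in> diagram lam" "t M = Suc r" for M
    using that N bij by (auto simp: bij_betw_def inj_on_def)
  have shape: "shape_upto lam t (Suc r) = insert N (shape_upto lam t r)"
  proof (intro equalityI subsetI)
    fix M assume "M \<in> shape_upto lam t (Suc r)"
    then show "M \<in> insert N (shape_upto lam t r)"
      using uniq[of M] by (auto simp: shape_upto_def le_Suc_eq)
  next
    fix M assume "M \<in> insert N (shape_upto lam t r)"
    then show "M \<in> shape_upto lam t (Suc r)"
      using N by (auto simp: shape_upto_def)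
  qed
  have notin: "N \<notin> shape_upto lam t r" using N by (simp add: shape_upto_def)
  have "removable (length kap) (shape_upto lam t (Suc r)) N"
    using notin young_shape_upto[OF lam t, of r]
    by (simp add: removable_def shape is_diagram_iff_young)
  then have "of_int (node_deg kap (shape_upto lam t (Suc r)) N) = node_weight kap N"
    using young_shape_upto[OF lam t] by (intro node_deg_parity)
  moreover have "finite (shape_upto lam t r)"
    using finite_diagram by (simp add: shape_upto_def)
  ultimately show ?case
    using Suc notin by (simp add: shape flip: N_def)
qed

section \<open>The parity of a multipartition as a sum over nodes\<close>

lemma sum_of_bool_even: "(\<Sum>b = 1..n. of_bool (even b) :: bit) = of_nat (n div 2)"
proof (induction n)
  case (Suc n)
  then show ?case by (cases "even n") (auto elim!: evenE oddE)
qed simp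

text \<open>Grouping the nodes by component, the even columns of each row supply the halved parts of
  \<open>part_parity\<close>. Exchanging the sums over nodes and over later components turns the
  residue tests into \<open>res_count\<close>.\<close>

lemma mp_parity_eq_sum:
  assumes "length lam = length kap"
  shows "mp_parity kap lam = (\<Sum>N\<in>diagram lam. node_weight kap N)"
proof -
  let ?l = "length kap"
  define D where "D j = {N \<in> diagram lam. snd (snd N) = j}" for j
  have fin: "finite (D j)" for j using finite_diagram by (simp add: D_def)
  have group: "(\<Sum>N\<in>diagram lam. w N) = (\<Sum>j = 1..?l. \<Sum>N\<in>D j. w N)" for w :: "node \<Rightarrow> bit"
    unfolding D_def using assms finite_diagram
    by (intro sum.group[symmetric]) (simp_all, auto simp: diagram_def)
  have D_eq: "D j = (\<lambda>(a, b). (Suc a, b, j)) `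
      (SIGMA a:{..<length (lam ! (j - 1))}. {1..lam ! (j - 1) ! a})" if "j \<in> {1..?l}" for j
  proof -
    have "(a, b, j) \<in> (\<lambda>(a, b). (Suc a, b, j)) `
      (SIGMA a:{..<length (lam ! (j - 1))}. {1..lam ! (j - 1) ! a})"
      if "(a, b, j) \<in> diagram lam" for a b
      using that by (intro image_eqI[where x = "(a - 1, b)"])
        (auto simp: diagram_def part_def split: if_splits)
    then show ?thesis using that assms by (auto simp: D_def diagram_def part_def)
  qed
  have even_part: "(\<Sum>N\<in>D j. of_bool (even (fst (snd N)))) = part_parity (lam ! (j - 1))"
    if "j \<in> {1..?l}" for j
  proof -
    have "(\<Sum>N\<in>D j. of_bool (even (fst (snd N)))) =
        (\<Sum>a<length (lam ! (j - 1)). \<Sum>b = 1..lam ! (j - 1) ! a. of_bool (even b) :: bit)"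
      by (simp add: D_eq[OF that] sum.reindex inj_on_def sum.Sigma case_prod_unfold)
    also have "\<dots> = of_nat (\<Sum>a<length (lam ! (j - 1)). lam ! (j - 1) ! a div 2)"
      by (simp only: sum_of_bool_even of_nat_sum)
    finally show ?thesis by (simp add: part_parity_def sum_list_sum_nth atLeast0LessThan)
  qed
  have res_part: "(\<Sum>N\<in>D j. of_bool (node_res kap N = i)) = (of_nat (res_count kap lam i j) :: bit)"
    for i j
  proof -
    have "{(a, b, m). (a, b, m) \<in> diagram lam \<and> m = j \<and> node_res kap (a, b, m) = i} =
        {N \<in> D j. node_res kap N = i}"
      by (auto simp: D_def)
    then show ?thesis by (simp add: res_count_def of_nat_card_bit fin)
  qed
  have "(\<Sum>N\<in>D j. node_weight kap N) = part_parity (lam ! (j - 1)) +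
      (\<Sum>m = j + 1..?l. of_nat (res_count kap lam (kap ! (m - 1)) j))" if "j \<in> {1..?l}" for j
  proof -
    have "(\<Sum>N\<in>D j. node_weight kap N) = (\<Sum>N\<in>D j. of_bool (even (fst (snd N))) +
        (\<Sum>m = j + 1..?l. of_bool (node_res kap N = kap ! (m - 1))))"
      by (rule sum.cong) (auto simp: D_def node_weight_def atLeastSucAtMost_greaterThanAtMost)
    also have "\<dots> = part_parity (lam ! (j - 1)) +
        (\<Sum>m = j + 1..?l. \<Sum>N\<in>D j. of_bool (node_res kap N = kap ! (m - 1)))"
      by (simp add: sum.distrib even_part[OF that] sum.swap[of _ _ "D j"])
    finally show ?thesis by (simp add: res_part)
  qed
  then have "(\<Sum>N\<in>diagram lam. node_weight kap N) = (\<Sum>j = 1..?l. part_parity (lam ! (j - 1))) +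
      (\<Sum>j = 1..?l. \<Sum>m = j + 1..?l. of_nat (res_count kap lam (kap ! (m - 1)) j))"
    by (simp add: group sum.distrib)
  \<comment> \<open>The last component has no later ones, so its inner sum is empty and the upper
    limit may drop by one.\<close>
  also have "(\<Sum>j = 1..?l. \<Sum>m = j + 1..?l. of_nat (res_count kap lam (kap ! (m - 1)) j)) =
      (\<Sum>j = 1..?l - 1. \<Sum>m = j + 1..?l. of_nat (res_count kap lam (kap ! (m - 1)) j) :: bit)"
    by (rule sum.mono_neutral_right) auto
  finally show ?thesis by (simp add: mp_parity_def)
qed

lemma tab_deg_parity:
  assumes "lam \<in> multipartitions (length kap) d" and "t \<in> std_tableaux lam"
  shows "of_int (tab_deg kap lam t) = mp_parity kap lam"
proof -
  have "bij_betw t (diagram lam) {1..mp_size lam}"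
    using assms(2) by (simp add: std_tableaux_def tableaux_def)
  then have "shape_upto lam t (mp_size lam) = diagram lam"
    by (auto simp: shape_upto_def dest: bij_betwE)
  moreover have "length lam = length kap" using assms(1) by (simp add: multipartitions_def)
  ultimately show ?thesis
    using deg_upto_parity[OF assms order_refl] by (simp add: tab_deg_def mp_parity_eq_sum)
qed

section \<open>Evaluation of Laurent polynomials at \<open>u\<close>\<close>

lemma laurent_at_u_0: "laurent_at_u 0 = 0"
  by (simp add: laurent_at_u_def zero_laurent_u.abs_eq)

lemma laurent_at_u_add: "laurent_at_u (f + g) = laurent_at_u f + laurent_at_u g"
  by (simp add: laurent_at_u_def plus_laurent_u.abs_eq)

lemma laurent_at_u_mult: "laurent_at_u (f * g) = laurent_at_u f * laurent_at_u g"
  by (simp add: laurent_at_u_def times_laurent_u.abs_eq)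

lemma laurent_at_u_of_nat: "laurent_at_u (of_nat n) = of_nat n"
  by (induction n)
    (simp_all add: laurent_at_u_0 laurent_at_u_add, simp add: laurent_at_u_def one_laurent_u.abs_eq)

lemma laurent_at_u_sum: "laurent_at_u (sum f A) = (\<Sum>x\<in>A. laurent_at_u (f x))"
  by (induction A rule: infinite_finite_induct) (simp_all add: laurent_at_u_0 laurent_at_u_add)

text \<open>Multiplication by \<open>q_var ^ 2\<close> becomes trivial in the quotient, so an
  exponent matters only modulo 2.\<close>

lemma laurent_at_u_q_power: "laurent_at_u (Poly_Mapping.single n 1) = u_pow (of_int n)"
proof -
  have shift: "laurent_at_u (Poly_Mapping.single (n + 2) 1) = laurent_at_u (Poly_Mapping.single n 1)"
    for n
  proof -
    have "Poly_Mapping.single (n + 2) 1 = (Poly_Mapping.single n 1 :: laurent) * q_var ^ 2"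
      by (simp add: q_var_def power2_eq_square mult_single)
    then show ?thesis
      using u_elt_square by (simp add: laurent_at_u_mult power2_eq_square u_elt_def)
  qed
  have base: "laurent_at_u (Poly_Mapping.single e 1) = u_pow (of_int e)" if "e = 0 \<or> e = 1" for e
    using that by (auto simp: u_pow_def u_elt_def q_var_def laurent_at_u_def one_laurent_u.abs_eq)
  have "laurent_at_u (Poly_Mapping.single (e + 2 * k) 1) = laurent_at_u (Poly_Mapping.single e 1)"
    for e k :: int
  \<comment> \<open>Exponents may be negative, so the induction runs in both directions from
    0.\<close>
  proof (induction k rule: int_induct[where k = 0])
    case (step1 i)
    then show ?case using shift[of "e + 2 * i"] by (simp add: algebra_simps)
  next
    case (step2 i)
    then show ?case using shift[of "e + 2 * (i - 1)"] by (simp add: algebra_simps)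
  qed simp
  from this[of "n mod 2" "n div 2"]
  have "laurent_at_u (Poly_Mapping.single n 1) = laurent_at_u (Poly_Mapping.single (n mod 2) 1)"
    by simp
  also have "\<dots> = u_pow (of_int (n mod 2))"
    by (rule base) presburger
  also have "(of_int (n mod 2) :: bit) = of_int n"
  proof -
    have "(of_int (n mod 2 + 2 * (n div 2)) :: bit) = of_int (n mod 2)"
      by (simp only: of_int_add of_int_mult) simp
    then show ?thesis by simp
  qed
  finally show ?thesis .
qed

section \<open>The graded dimension of the Specht module at \<open>u\<close>\<close>

theorem theorem2:
  fixes l d :: nat and kap :: "bit list" and lam :: multipartition
    and rex :: "multipartition \<Rightarrow> tableau \<Rightarrow> nat list"
  assumes "length kap = l"
    and "reduced_choice l d rex"
    and "lam \<in> multipartitions l d"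
  shows "laurent_at_u (qdim (specht kap d rex lam :: ('f::field) specht_module))
           \<in> {of_nat n * u_pow (mp_parity kap lam) | n :: nat. True}"
proof -
  let ?S = "specht kap d rex lam :: 'f specht_module"
  define I where "I = {n. gm_component ?S n \<noteq> {0}}"
  define D where "D n = pm.dim (gm_component ?S n)" for n
  \<comment> \<open>A nonzero component cannot be the span of the empty set, so some standard
    tableau has degree \<open>n\<close>, and all such degrees share one parity.\<close>
  have parity: "of_int n = mp_parity kap lam" if "n \<in> I" for n
  proof -
    have "{t \<in> std_tableaux lam. tab_deg kap lam t = n} \<noteq> {}"
    proof
      assume "{t \<in> std_tableaux lam. tab_deg kap lam t = n} = {}"
      then have "{Poly_Mapping.single t (1::'f) | t. t \<in> std_tableaux lam \<and> tab_deg kap lam t = n} = {}"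
        by blast
      then have "gm_component ?S n = {0}"
        by (simp only: specht_def graded_module.select_convs pm.span_empty)
      then show False using that by (simp add: I_def)
    qed
    then obtain t where "t \<in> std_tableaux lam" "tab_deg kap lam t = n" by blast
    then show ?thesis using assms(1,3) tab_deg_parity[of lam kap d t] by simp
  qed
  \<comment> \<open>Splitting off the coefficient as a natural number leaves a pure power of
    \<open>q_var\<close>, whose value at \<open>u\<close> is known.\<close>
  have single: "Poly_Mapping.single n (int k) = of_nat k * Poly_Mapping.single n 1" for n :: int and k
    by (simp only: single_of_nat[symmetric] mult_single add_0 mult_1_right)
  have "laurent_at_u (qdim ?S) = (\<Sum>n\<in>I. laurent_at_u (of_nat (D n) * Poly_Mapping.single n 1))"
    by (simp only: qdim_def laurent_at_u_sum I_def D_def single)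
  also have "\<dots> = (\<Sum>n\<in>I. of_nat (D n) * u_pow (mp_parity kap lam))"
    by (simp add: laurent_at_u_mult laurent_at_u_of_nat laurent_at_u_q_power parity)
  \<comment> \<open>All terms carry the same power of \<open>u\<close>, so the natural coefficients
    simply add up.\<close>
  also have "\<dots> = of_nat (\<Sum>n\<in>I. D n) * u_pow (mp_parity kap lam)"
    by (simp add: sum_distrib_right)
  finally show ?thesis by blast
qed

end
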